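(* Consider the following game with $p\ge 1$ players, lined up from player $1$ (front) to player $p$ (back). Players take turns throwing a dart: the player at the front of the line throws; if the dart lands strictly closer to the center than all previously thrown darts, the player moves to the back of the line, and otherwise the player is eliminated. The game ends when only one player remains. The distances of the successive darts to the center are i.i.d. random variables with a continuous distribution (so ties occur with probability zero). For $n\ge 0$ and $p\ge1$ let $Q_{n,p}$ be the probability that the $p$-player game ends after exactly $n$ throws (for $p=1$ the game ends after $0$ throws). Then, as formal power series, $$Q(u,z):=\sum_{n\ge0,\ p\ge1} Q_{n,p}\,u^{p} z^n=u+\frac{u^2}{1-u}\left(1+\frac{z-1}{(1-uz)^{1/u}}\right).$$
   Context: Here $(1-uz)^{1/u}=\exp\!\big(\tfrac1u\log(1-uz)\big)$, whose expansion in powers of $z$ has coefficients polynomial in $u$, so the right-hand side is a formal power series in $u,z$. *)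

theory Defs
  imports
    "HOL-Probability.Probability"
    "HOL-Computational_Algebra.Formal_Laurent_Series"
begin

text \<open>
  Throws are numbered from 0, so \<open>x k\<close> is the distance to the centre of the \<open>(k+1)\<close>-st dart.
  The first dart has no predecessors, hence vacuously beats all of them: its thrower survives.
\<close>

definition closer_than_all_previous :: "(nat \<Rightarrow> real) \<Rightarrow> nat \<Rightarrow> bool" where
  "closer_than_all_previous x k \<longleftrightarrow> (\<forall>j<k. x k < x j)"

text \<open>
  The line of remaining players (front first) after \<open>n\<close> throws. Once a single player remains the
  line no longer changes; the case of an empty line does not arise for \<open>p \<ge> 1\<close>.
\<close>

primrec line_after :: "(nat \<Rightarrow> real) \<Rightarrow> nat \<Rightarrow> nat \<Rightarrow> nat list" where
  "line_after x p 0 = [1..<Suc p]"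
| "line_after x p (Suc n) =
    (case line_after x p n of
       [] \<Rightarrow> []
     | [a] \<Rightarrow> [a]
     | a # b # rest \<Rightarrow>
         if closer_than_all_previous x n then (b # rest) @ [a] else b # rest)"

definition ends_after :: "(nat \<Rightarrow> real) \<Rightarrow> nat \<Rightarrow> nat \<Rightarrow> bool" where
  "ends_after x p n \<longleftrightarrow>
     length (line_after x p n) = 1 \<and> (\<forall>m<n. length (line_after x p m) \<noteq> 1)"

definition end_prob :: "'a measure \<Rightarrow> (nat \<Rightarrow> 'a \<Rightarrow> real) \<Rightarrow> nat \<Rightarrow> nat \<Rightarrow> real" where
  "end_prob M X n p = measure M {\<omega> \<in> space M. ends_after (\<lambda>k. X k \<omega>) p n}"

text \<open>
  Since \<open>1/u\<close> occurs, bivariate series are treated as power series in \<open>z\<close> whose coefficients are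
  formal Laurent series in \<open>u\<close>; the power series ring in \<open>u, z\<close> embeds coefficientwise via
  \<^const>\<open>fps_to_fls\<close>.
\<close>

abbreviation var_u :: "real fls fps" where
  "var_u \<equiv> fps_const fls_X"

abbreviation var_z :: "real fls fps" where
  "var_z \<equiv> fps_X"

definition Q_series :: "'a measure \<Rightarrow> (nat \<Rightarrow> 'a \<Rightarrow> real) \<Rightarrow> real fls fps" where
  "Q_series M X =
     Abs_fps (\<lambda>n. fps_to_fls (Abs_fps (\<lambda>p. if p \<ge> 1 then end_prob M X n p else 0)))"

text \<open>
  \<open>(1 - uz)\<^sup>1\<^sup>/\<^sup>u = exp ((1/u) log (1 - uz))\<close>; note that \<^term>\<open>fps_ln 1\<close> is the
  series of \<open>log (1 + t)\<close>.
\<close>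

definition one_minus_uz_powr_inv_u :: "real fls fps" where
  "one_minus_uz_powr_inv_u =
     fps_compose (fps_exp 1) ((1 / var_u) * fps_compose (fps_ln 1) (- (var_u * var_z)))"

end

theory Submission
  imports Defs
begin

text \<open>
  A player survives a throw iff that throw is a record, so after \<open>n\<close> throws a game with \<open>p \<ge> 2\<close>
  players has lost as many of them as there are non-records among the first \<open>n\<close> throws (until one
  is left); hence it ends at throw \<open>n\<close> iff that throw is the \<open>(p-1)\<close>-st non-record. The
  \<open>k\<close>-th throw is a record with probability \<open>1/k\<close>, independently of the earlier record pattern,
  so the number of non-records among the first \<open>n\<close> throws has generating function
  \<open>A\<^sub>n(u) = (\<Prod>k=1..n. (1 + (k-1)u)/k)\<close>, which is also the coefficient of \<open>z\<^sup>n\<close> in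
  \<open>(1 - uz)\<close> to the power \<open>-1/u\<close>. For \<open>n \<ge> 1\<close> the coefficient of \<open>z\<^sup>n\<close> in
  \<open>Q\<close> is thus \<open>u\<^sup>2 A\<^bsub>n-1\<^esub>(u) (n-1)/n = u\<^sup>2 (A\<^bsub>n-1\<^esub>(u) - A\<^sub>n(u)) / (1 - u)\<close>.
\<close>

unbundle no vec_syntax

section \<open>Records of an i.i.d. sequence\<close>

context cdf_distribution
begin

text \<open>
  The law is the image of the uniform distribution on \<open>(0,1)\<close> under the quantile function \<open>I\<close>, and
  \<open>C \<circ> I\<close> is the identity by continuity.
\<close>
lemma survival_power_integral:
  assumes "continuous_on UNIV C"
  shows "(\<integral>s. indicator {t<..} s * (1 - C s) ^ n \<partial>M) = (1 - C t) ^ Suc n / real (Suc n)"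
proof -
  let ?\<Omega> = "restrict_space lborel {0<..<1::real}"
  let ?f = "\<lambda>s. indicator {t<..} s * (1 - C s) ^ n"
  have Ct: "0 \<le> C t" "C t \<le> 1"
    by (rule cdf_nonneg, rule cdf_bounded_prob)
  have CI: "C (I w) = w" if w: "w \<in> {0<..<1}" for w
  proof (rule antisym)
    show "w \<le> C (I w)"
      using w pseudoinverse[of w "I w"] by (meson greaterThanLessThan_iff order_refl)
    \<comment> \<open>Every \<open>x\<close> to the left of \<open>I w\<close> satisfies
      \<open>C x \<le> w\<close>; continuity carries the bound over to \<open>I w\<close>
      itself.\<close>
    have "isCont C (I w)"
      using assms by (simp add: continuous_on_eq_continuous_at)
    then have "(C \<longlongrightarrow> C (I w)) (at_left (I w))"
      unfolding isCont_def by (rule filterlim_mono) (auto intro: at_le)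
    moreover have "eventually (\<lambda>x. C x \<le> w) (at_left (I w))"
    proof -
      have "C x \<le> w" if "x < I w" for x
        using that w pseudoinverse[of w x] by (meson greaterThanLessThan_iff linear not_le)
      then show ?thesis
        unfolding eventually_at_filter by (intro always_eventually) blast
    qed
    ultimately show "C (I w) \<le> w"
      by (intro tendsto_upperbound) auto
  qed
  have "(\<integral>s. ?f s \<partial>M) = (\<integral>s. ?f s \<partial>distr ?\<Omega> borel I)"
    by (simp add: distr_I_eq_M)
  also have "\<dots> = (\<integral>w. ?f (I w) \<partial>?\<Omega>)"
    by (rule integral_distr) auto
  also have "\<dots> = (\<integral>w. indicator {C t<..} w * (1 - w) ^ n \<partial>?\<Omega>)"
  proof (rule Bochner_Integration.integral_cong)
    fix w assume "w \<in> space ?\<Omega>"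
    then have w: "w \<in> {0<..<1}" by (simp add: space_restrict_space)
    then have "t < I w \<longleftrightarrow> C t < w"
      using pseudoinverse[of w t] by (meson greaterThanLessThan_iff not_le)
    then show "?f (I w) = indicator {C t<..} w * (1 - w) ^ n"
      using CI[OF w] by (simp add: indicator_def)
  qed simp
  also have "\<dots> = (\<integral>w. indicator {0<..<1} w *\<^sub>R (indicator {C t<..} w * (1 - w) ^ n) \<partial>lborel)"
    by (subst integral_restrict_space) auto
  \<comment> \<open>The integrands can differ only at \<open>C t\<close> and 1, a Lebesgue null
    set.\<close>
  also have "\<dots> = (\<integral>w. (1 - w) ^ n * indicator {C t..1} w \<partial>lborel)"
  proof (rule integral_cong_AE)
    show "AE w in lborel. indicator {0<..<1} w *\<^sub>R (indicator {C t<..} w * (1 - w) ^ n) = (1 - w) ^ n * indicator {C t..1} w"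
      using AE_lborel_singleton[of "C t"] AE_lborel_singleton[of "1::real"]
      by eventually_elim (use Ct in \<open>auto simp: indicator_def\<close>)
  qed auto
  also have "\<dots> = - ((1 - 1) ^ Suc n / real (Suc n)) - - ((1 - C t) ^ Suc n / real (Suc n))"
  proof (rule integral_FTC_Icc_real)
    fix x :: real
    show "((\<lambda>w. - ((1 - w) ^ Suc n / real (Suc n))) has_real_derivative (1 - x) ^ n) (at x)"
      by (auto intro!: derivative_eq_intros simp del: power_Suc of_nat_Suc)
  qed (auto simp: Ct intro!: continuous_intros)
  finally show ?thesis by simp
qed

end

section \<open>Conditioning on the newest throw\<close>

locale iid_continuous = prob_space M for M :: "'a measure" +
  fixes X :: "nat \<Rightarrow> 'a \<Rightarrow> real"
  assumes indep: "indep_vars (\<lambda>_. borel) X UNIV"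
    and ident: "distr M borel (X k) = distr M borel (X 0)"
    and cont: "continuous_on UNIV (cdf (distr M borel (X 0)))"
begin

abbreviation "law \<equiv> distr M borel (X 0)"
abbreviation "survival t \<equiv> 1 - cdf law t"

lemma X_measurable [measurable]: "X k \<in> borel_measurable M"
  using indep by (auto simp: indep_vars_def)

sublocale law: cdf_distribution law
proof -
  interpret L: prob_space law by (rule prob_space_distr) measurable
  show "cdf_distribution law"
    by (intro cdf_distribution.intro real_distribution.intro real_distribution_axioms.intro L.prob_space_axioms) auto
qed

text \<open>Fubini: throw \<open>n\<close> is independent of the block of earlier throws, so its
  value can be frozen at \<open>s\<close> and integrated out. By \<open>local\<close>, the full
  sequence may be replaced by its restriction to \<open>{..<n}\<close>, on which measurability is
  assumed.\<close>

lemma prob_prefix_pair: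
  fixes R :: "(nat \<Rightarrow> real) \<Rightarrow> real \<Rightarrow> bool"
  assumes R [measurable]:
      "Measurable.pred (PiM {..<n} (\<lambda>_. borel) \<Otimes>\<^sub>M borel) (\<lambda>(x, y). R x y)"
    and local: "\<And>x y s. (\<And>k. k < n \<Longrightarrow> x k = y k) \<Longrightarrow> R x s = R y s"
  shows "prob {\<omega> \<in> space M. R (\<lambda>k. X k \<omega>) (X n \<omega>)}
       = (\<integral>s. prob {\<omega> \<in> space M. R (\<lambda>k. X k \<omega>) s} \<partial>law)"
proof -
  let ?P = "PiM {..<n} (\<lambda>_. borel) :: (nat \<Rightarrow> real) measure"
  let ?B = "PiM {n} (\<lambda>_. borel) :: (nat \<Rightarrow> real) measure"
  let ?Y = "\<lambda>\<omega>. \<lambda>k\<in>{..<n}. X k \<omega>" and ?Z = "\<lambda>\<omega>. \<lambda>k\<in>{n}. X k \<omega>"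
  have Y [measurable]: "?Y \<in> measurable M ?P" by measurable
  have Z [measurable]: "?Z \<in> measurable M ?B" by measurable
  let ?N = "distr M ?P ?Y" and ?L = "distr M ?B ?Z"
  define g where "g s = prob {\<omega> \<in> space M. R (\<lambda>k. X k \<omega>) s}" for s
  interpret N: prob_space ?N by (rule prob_space_distr) measurable
  interpret L: prob_space ?L by (rule prob_space_distr) measurable
  interpret P: pair_prob_space ?N ?L ..
  let ?S = "{p \<in> space (?P \<Otimes>\<^sub>M ?B). case p of (x, f) \<Rightarrow> R x (f n)}"
  have R' [measurable]: "Measurable.pred (?P \<Otimes>\<^sub>M ?B) (\<lambda>(x, f). R x (f n))"
  proof -
    have "(\<lambda>(x, f). (x, f n)) \<in> measurable (?P \<Otimes>\<^sub>M ?B) (?P \<Otimes>\<^sub>M borel)" by measurable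
    from measurable_compose[OF this R] show ?thesis by (simp add: case_prod_beta')
  qed
  have "?S \<in> sets (?P \<Otimes>\<^sub>M ?B)" by measurable
  then have S: "?S \<in> sets (?N \<Otimes>\<^sub>M ?L)" by (simp cong: sets_pair_measure_cong)
  have RY: "R (?Y \<omega>) s = R (\<lambda>k. X k \<omega>) s" for \<omega> s by (rule local) simp
  have g_measurable [measurable]: "g \<in> borel_measurable borel"
  proof -
    \<comment> \<open>The coordinates are swapped because \<open>measurable_emeasure_Pair\<close>
      freezes the first one.\<close>
    have "(\<lambda>s. emeasure ?N (Pair s -` {p \<in> space (borel \<Otimes>\<^sub>M ?N). R (snd p) (fst p)})) \<in> borel_measurable borel"
    proof (rule N.measurable_emeasure_Pair)
      have "Measurable.pred (borel \<Otimes>\<^sub>M ?P) (\<lambda>p. R (snd p) (fst p))"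
      proof -
        have "(\<lambda>p. (snd p, fst p)) \<in> measurable (borel \<Otimes>\<^sub>M ?P) (?P \<Otimes>\<^sub>M (borel :: real measure))"
          by measurable
        from measurable_compose[OF this R] show ?thesis by simp
      qed
      then have "{p \<in> space (borel \<Otimes>\<^sub>M ?P). R (snd p) (fst p)} \<in> sets (borel \<Otimes>\<^sub>M ?P)"
        by measurable
      then show "{p \<in> space (borel \<Otimes>\<^sub>M ?N). R (snd p) (fst p)} \<in> sets (borel \<Otimes>\<^sub>M ?N)"
        by (simp add: space_pair_measure cong: sets_pair_measure_cong)
    qed
    moreover have "enn2real (emeasure ?N (Pair s -` {p \<in> space (borel \<Otimes>\<^sub>M ?N). R (snd p) (fst p)})) = g s" for s
    proof -
      have "Measurable.pred ?P (\<lambda>x. R x s)"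
        using measurable_compose[OF measurable_Pair2' R, of s] by simp
      then have "{x \<in> space ?P. R x s} \<in> sets ?P" by measurable
      moreover have "Pair s -` {p \<in> space (borel \<Otimes>\<^sub>M ?N). R (snd p) (fst p)} = {x \<in> space ?P. R x s}"
        by (auto simp: space_pair_measure)
      ultimately show ?thesis
        using RY measurable_space[OF Y]
        by (simp add: emeasure_distr g_def measure_def vimage_def Int_def conj_commute cong: conj_cong)
    qed
    ultimately show ?thesis
      by (auto dest: borel_measurable_enn2real)
  qed
  \<comment> \<open>Independence enters here: the joint law of the two blocks is the product of
    their laws.\<close>
  have eq: "?N \<Otimes>\<^sub>M ?L = distr M (?P \<Otimes>\<^sub>M ?B) (\<lambda>\<omega>. (?Y \<omega>, ?Z \<omega>))"
    using indep_var_restrict[OF indep, of "{..<n}" "{n}"]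
    unfolding indep_var_distribution_eq by simp
  have "prob {\<omega> \<in> space M. R (\<lambda>k. X k \<omega>) (X n \<omega>)} = measure (?N \<Otimes>\<^sub>M ?L) ?S"
    unfolding eq using RY
    by (subst measure_distr) (auto intro!: arg_cong[where f=prob] simp: space_pair_measure space_PiM)
  also have "\<dots> = enn2real (\<integral>\<^sup>+f. emeasure ?N ((\<lambda>x. (x, f)) -` ?S) \<partial>?L)"
    unfolding measure_def P.emeasure_pair_measure_alt2[OF S] ..
  also have "(\<integral>\<^sup>+f. emeasure ?N ((\<lambda>x. (x, f)) -` ?S) \<partial>?L) = (\<integral>\<^sup>+f. ennreal (g (f n)) \<partial>?L)"
  proof (rule nn_integral_cong)
    fix f assume f: "f \<in> space ?L"
    have "Measurable.pred ?P (\<lambda>x. R x (f n))"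
      using measurable_compose[OF measurable_Pair2' R, of "f n"] by simp
    then have "{x \<in> space ?P. R x (f n)} \<in> sets ?P" by measurable
    moreover have "(\<lambda>x. (x, f)) -` ?S = {x \<in> space ?P. R x (f n)}"
      using f by (auto simp: space_pair_measure)
    ultimately show "emeasure ?N ((\<lambda>x. (x, f)) -` ?S) = ennreal (g (f n))"
      using RY measurable_space[OF Y]
      by (simp add: emeasure_distr g_def emeasure_eq_measure vimage_def Int_def conj_commute cong: conj_cong)
  qed
  also have "\<dots> = (\<integral>\<^sup>+\<omega>. ennreal (g (X n \<omega>)) \<partial>M)"
    by (subst nn_integral_distr) auto
  also have "\<dots> = (\<integral>\<^sup>+s. ennreal (g s) \<partial>law)"
    by (subst ident[of n, symmetric], subst nn_integral_distr) auto
  also have "enn2real \<dots> = (\<integral>s. g s \<partial>law)"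
    by (subst integral_eq_nn_integral) (auto simp: g_def)
  finally show ?thesis unfolding g_def .
qed

end

section \<open>Expansion of the closed form\<close>

text \<open>The coefficient of \<open>u^j\<close> will be the probability of \<open>j\<close>
  non-records among \<open>n\<close> throws: the next throw is a record with weight
  \<open>1/(n+1)\<close> and otherwise contributes \<open>n u/(n+1)\<close>.\<close>

primrec nonrecord_gf :: "nat \<Rightarrow> real fps" where
  "nonrecord_gf 0 = 1"
| "nonrecord_gf (Suc n) =
     fps_const (1 / real (Suc n)) * (1 + fps_const (real n) * fps_X) * nonrecord_gf n"

text \<open>The recursion without denominators, inside the Laurent series; both the differential
  equation below and the telescoping of the closed form use it.\<close>

lemma nonrecord_gf_Suc_fls:
  "of_nat (Suc n) * fps_to_fls (nonrecord_gf (Suc n))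
     = (1 + of_nat n * fls_X) * fps_to_fls (nonrecord_gf n)"
proof -
  have "of_nat (Suc n) * nonrecord_gf (Suc n) = (1 + of_nat n * fps_X) * nonrecord_gf n"
    by (simp add: fps_of_nat[symmetric] mult.assoc[symmetric] del: of_nat_Suc)
  from arg_cong[OF this, of fps_to_fls] show ?thesis
    by (simp add: fls_times_fps_to_fls fps_to_fls_of_nat del: of_nat_Suc nonrecord_gf.simps)
qed

text \<open>
  With \<open>E = (1 - uz)\<^sup>1\<^sup>/\<^sup>u\<close> and \<open>B\<close> its claimed inverse, \<open>(1 - uz) E' = - E\<close> and
  \<open>(1 - uz) B' = B\<close>, so \<open>E B\<close> is constant.
\<close>
lemma one_minus_uz_powr_inv_u_inverse:
  "one_minus_uz_powr_inv_u * Abs_fps (\<lambda>n. fps_to_fls (nonrecord_gf n)) = 1"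
proof -
  define B where "B = Abs_fps (\<lambda>n. fps_to_fls (nonrecord_gf n))"
  define L where "L = (1 / var_u) * (fps_ln 1 oo - (var_u * var_z))"
  define E where "E = fps_exp 1 oo L"
  define w where "w = 1 - var_u * var_z"
  have w: "w $ 0 \<noteq> 0" "w \<noteq> 0" by (auto simp: w_def fps_eq_iff intro!: exI[of _ 0])
  \<comment> \<open>\<open>var_u\<close> is a unit because its constant coefficient
    \<open>fls_X\<close> is nonzero in the field of Laurent series.\<close>
  have u: "(1 / var_u) * var_u = 1"
    by (simp add: fps_divide_unit fps_const_inverse)
  have L0: "L $ 0 = 0" by (simp add: L_def)
  have dln: "fps_deriv (fps_ln 1 oo - (var_u * var_z)) = - var_u * inverse w"
    by (subst fps_compose_deriv)
       (simp_all add: fps_ln_deriv fps_inverse_compose fps_compose_add_distrib w_def)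
  have "w * fps_deriv E = - E"
  proof -
    have "fps_deriv (1 / var_u) = 0" by (simp add: fps_divide_unit fps_const_inverse)
    then have "fps_deriv L = - ((1 / var_u) * var_u) * inverse w"
      unfolding L_def fps_deriv_mult dln by (simp only: mult_minus_left mult_minus_right mult.assoc) simp
    then have "fps_deriv L = - inverse w" unfolding u by simp
    then show ?thesis
      using w inverse_mult_eq_1'[of w]
      by (simp add: E_def fps_compose_deriv[OF L0] mult.left_commute[of w])
  qed
  \<comment> \<open>Coefficientwise this is \<open>(n+1) A_(n+1) - n u A_n = A_n\<close>, the
    recursion.\<close>
  moreover have "w * fps_deriv B = B"
  proof (rule fps_ext)
    fix n
    show "(w * fps_deriv B) $ n = B $ n"
      using nonrecord_gf_Suc_fls[of n]
      by (cases n) (simp_all add: w_def B_def left_diff_distrib mult.assoc algebra_simps del: nonrecord_gf.simps(2))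
  qed
  ultimately have "w * fps_deriv (E * B) = 0"
    by (simp add: algebra_simps mult.left_commute[of w])
  then have "fps_deriv (E * B) = 0" using w by simp
  then have "E * B = fps_const ((E * B) $ 0)" by (simp only: fps_deriv_eq_0_iff)
  also have "(E * B) $ 0 = 1" by (simp add: E_def B_def)
  finally show ?thesis by (simp add: E_def B_def L_def one_minus_uz_powr_inv_u_def)
qed

text \<open>The denominator \<open>1 - u\<close> cancels since
  \<open>A_m - A_(m+1) = (1 - u) m/(m+1) A_m\<close>. Both sides are compared after multiplication
  by \<open>1 - var_u\<close>.\<close>

lemma closed_form_expansion:
  "var_u ^ 2 / (1 - var_u) * (1 + (var_z - 1) / one_minus_uz_powr_inv_u) =
   Abs_fps (\<lambda>n. case n of 0 \<Rightarrow> 0 | Suc m \<Rightarrow>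
     fps_to_fls (fps_const (real m / real (Suc m)) * fps_X ^ 2 * nonrecord_gf m))"
proof -
  define B where "B = Abs_fps (\<lambda>n. fps_to_fls (nonrecord_gf n))"
  define r where "r = Abs_fps (\<lambda>n. case n of 0 \<Rightarrow> 0 | Suc m \<Rightarrow>
     fps_to_fls (fps_const (real m / real (Suc m)) * fps_X ^ 2 * nonrecord_gf m))"
  have EB: "one_minus_uz_powr_inv_u * B = 1"
    unfolding B_def by (rule one_minus_uz_powr_inv_u_inverse)
  have "one_minus_uz_powr_inv_u $ 0 * B $ 0 = 1"
    using arg_cong[OF EB, of "\<lambda>f. f $ 0"] by simp
  then have "(var_z - 1) / one_minus_uz_powr_inv_u = (var_z - 1) * inverse one_minus_uz_powr_inv_u"
    by (intro fps_divide_unit) auto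
  also have "inverse one_minus_uz_powr_inv_u = B"
    using EB by (rule fps_inverse_unique)
  finally have *: "(var_z - 1) / one_minus_uz_powr_inv_u = (var_z - 1) * B" .
  have X1: "(1 - fls_X :: real fls) \<noteq> 0"
    by (auto simp: fls_eq_iff intro!: exI[of _ 0])
  have "var_u ^ 2 / (1 - var_u) = var_u ^ 2 * inverse (1 - var_u)"
    using X1 by (intro fps_divide_unit) simp
  then have **: "(1 - var_u) * (var_u ^ 2 / (1 - var_u)) = var_u ^ 2"
    using X1 inverse_mult_eq_1'[of "1 - var_u"] by (simp add: mult.left_commute)
  have r: "var_u ^ 2 * (1 + (var_z - 1) * B) = (1 - var_u) * r"
  proof (rule fps_ext)
    fix n
    show "(var_u ^ 2 * (1 + (var_z - 1) * B)) $ n = ((1 - var_u) * r) $ n"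
    proof (cases n)
      case 0 then show ?thesis by (simp add: B_def r_def power2_eq_square)
    next
      case (Suc m)
      let ?N = "of_nat (Suc m) :: real fls"
      let ?g = "\<lambda>n. fps_to_fls (nonrecord_gf n)"
      have N: "?N \<noteq> 0" by (simp del: of_nat_Suc)
      have l: "(var_u ^ 2 * (1 + (var_z - 1) * B)) $ n = fls_X ^ 2 * (?g m - ?g (Suc m))"
        by (simp add: Suc B_def fps_const_power left_diff_distrib del: nonrecord_gf.simps)
      have c: "fps_to_fls (fps_const (real m / real (Suc m)) * fps_X ^ 2 * nonrecord_gf m) * ?N
             = of_nat m * fls_X ^ 2 * ?g m"
      proof -
        have "(fps_const (real m / real (Suc m)) * fps_X ^ 2 * nonrecord_gf m) * of_nat (Suc m)
            = of_nat m * fps_X ^ 2 * nonrecord_gf m"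
        proof -
          have "fps_const (real m / real (Suc m)) * of_nat (Suc m) = of_nat m"
            by (simp add: fps_of_nat[symmetric] del: of_nat_Suc)
          then show ?thesis by (metis (no_types, lifting) mult.assoc mult.commute)
        qed
        from arg_cong[OF this, of fps_to_fls] show ?thesis
          by (simp only: fls_times_fps_to_fls fps_to_fls_of_nat fps_to_fls_power fps_X_to_fls)
      qed
      have r': "((1 - var_u) * r) $ n * ?N = (1 - fls_X) * (of_nat m * fls_X ^ 2 * ?g m)"
        unfolding c[symmetric]
        by (simp add: Suc r_def left_diff_distrib mult.assoc del: of_nat_Suc)
      have "(var_u ^ 2 * (1 + (var_z - 1) * B)) $ n * ?N
          = fls_X ^ 2 * (?g m * ?N - ?N * ?g (Suc m))"
        unfolding l by (simp add: algebra_simps del: nonrecord_gf.simps)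
      also have "\<dots> = ((1 - var_u) * r) $ n * ?N"
        unfolding r' nonrecord_gf_Suc_fls by (simp add: algebra_simps)
      finally show ?thesis using N by simp
    qed
  qed
  have "(1 - var_u) * (var_u ^ 2 / (1 - var_u) * (1 + (var_z - 1) * B)) = (1 - var_u) * r"
    unfolding r[symmetric] mult.assoc[symmetric] ** ..
  moreover have "1 - var_u \<noteq> 0" using X1 by (simp add: fps_eq_iff exI[of _ 0])
  ultimately show ?thesis unfolding * r_def[symmetric] by simp
qed

section \<open>Non-records and the end of the game\<close>

text \<open>The count continues past the end of the game, so it does not depend on the number of
  players.\<close>

primrec nonrecords :: "(nat \<Rightarrow> real) \<Rightarrow> nat \<Rightarrow> nat" where
  "nonrecords x 0 = 0"
| "nonrecords x (Suc n) = nonrecords x n + (if closer_than_all_previous x n then 0 else 1)"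

lemma closer_than_all_previous_cong:
  "(\<And>k. k \<le> n \<Longrightarrow> x k = y k) \<Longrightarrow> closer_than_all_previous x n = closer_than_all_previous y n"
  by (simp add: closer_than_all_previous_def)

lemma nonrecords_cong:
  "(\<And>k. k < n \<Longrightarrow> x k = y k) \<Longrightarrow> nonrecords x n = nonrecords y n"
proof (induction n)
  case (Suc n)
  then have "nonrecords x n = nonrecords y n" by simp
  moreover have "closer_than_all_previous x n = closer_than_all_previous y n"
    by (rule closer_than_all_previous_cong) (simp add: Suc.prems)
  ultimately show ?case by simp
qed simp

lemma nonrecords_mono: "m \<le> n \<Longrightarrow> nonrecords x m \<le> nonrecords x n"
  by (rule lift_Suc_mono_le) simp_all

text \<open>Each non-record removes one player until a single one is left; the line is then frozen,
  hence the \<open>max 1\<close>.\<close>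

lemma length_line_after:
  assumes "p \<ge> 1"
  shows "length (line_after x p n) = max 1 (p - nonrecords x n)"
proof (induction n)
  case 0
  show ?case using assms by simp
next
  case (Suc n)
  show ?case
  proof (cases "line_after x p n")
    case Nil
    then show ?thesis using Suc.IH by simp
  next
    case (Cons a r)
    then show ?thesis using Suc.IH by (cases r) auto
  qed
qed

lemma ends_after_0_iff: "p \<ge> 1 \<Longrightarrow> ends_after x p 0 \<longleftrightarrow> p = 1"
  by (simp add: ends_after_def)

text \<open>The deciding throw is the non-record numbered \<open>p - 1\<close>, preceded by
  \<open>p - 2\<close> others. The guard \<open>p \<ge> 2\<close> keeps the truncated
  \<open>p - 2\<close> from admitting \<open>p = 1\<close>.\<close>

lemma ends_after_Suc_iff:
  assumes "p \<ge> 1"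
  shows "ends_after x p (Suc m) \<longleftrightarrow>
    p \<ge> 2 \<and> nonrecords x m = p - 2 \<and> \<not> closer_than_all_previous x m"
proof
  assume "ends_after x p (Suc m)"
  then have "max 1 (p - nonrecords x (Suc m)) = 1" "max 1 (p - nonrecords x m) \<noteq> 1"
    by (auto simp: ends_after_def length_line_after[OF assms] simp del: line_after.simps)
  then show "p \<ge> 2 \<and> nonrecords x m = p - 2 \<and> \<not> closer_than_all_previous x m"
    by (auto split: if_splits)
next
  assume *: "p \<ge> 2 \<and> nonrecords x m = p - 2 \<and> \<not> closer_than_all_previous x m"
  \<comment> \<open>By monotonicity at most \<open>p - 2\<close> players are out at any earlier
    time.\<close>
  have "max 1 (p - nonrecords x k) \<noteq> 1" if "k < Suc m" for k
    using nonrecords_mono[of k m x] that * by auto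
  moreover have "max 1 (p - nonrecords x (Suc m)) = 1" using * by auto
  ultimately show "ends_after x p (Suc m)"
    unfolding ends_after_def length_line_after[OF assms] by blast
qed

lemma measurable_closer_than_all_previous [measurable]:
  assumes [measurable]: "\<And>k. k \<le> n \<Longrightarrow> (\<lambda>\<omega>. Y \<omega> k) \<in> borel_measurable N"
  shows "Measurable.pred N (\<lambda>\<omega>. closer_than_all_previous (Y \<omega>) n)"
proof -
  have "Measurable.pred N (\<lambda>\<omega>. \<forall>j\<in>{..<n}. Y \<omega> n < Y \<omega> j)"
    by (intro pred_intros_finite borel_measurable_less) auto
  then show ?thesis by (simp add: closer_than_all_previous_def)
qed

text \<open>Only the coordinates read need be measurable, so this applies on the finite product
  \<open>PiM {..<n}\<close>.\<close>

lemma measurable_nonrecords [measurable]: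
  "(\<And>k. k < n \<Longrightarrow> (\<lambda>\<omega>. Y \<omega> k) \<in> borel_measurable N) \<Longrightarrow>
     (\<lambda>\<omega>. nonrecords (Y \<omega>) n) \<in> measurable N (count_space UNIV)"
proof (induction n)
  case (Suc n)
  have [measurable]: "(\<lambda>\<omega>. nonrecords (Y \<omega>) n) \<in> measurable N (count_space UNIV)"
    using Suc by simp
  have [measurable]: "Measurable.pred N (\<lambda>\<omega>. closer_than_all_previous (Y \<omega>) n)"
    by (rule measurable_closer_than_all_previous) (simp add: Suc.prems)
  show ?case by simp
qed simp

section \<open>Joint law of the non-record count and a lower bound on the throws\<close>

context iid_continuous
begin

text \<open>
  Conditioning on the value \<open>s\<close> of the new throw, a record means that all earlier throws exceed
  \<open>s\<close>; tracking the lower bound on all throws is what makes the induction close.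
\<close>
lemma nonrecords_step:
  assumes IH: "\<And>s. prob {\<omega> \<in> space M. nonrecords (\<lambda>k. X k \<omega>) n = j \<and> (\<forall>k<n. s < X k \<omega>)}
                   = c * survival s ^ n"
  shows record_step: "prob {\<omega> \<in> space M. nonrecords (\<lambda>k. X k \<omega>) n = j \<and>
            closer_than_all_previous (\<lambda>k. X k \<omega>) n \<and> (\<forall>k<Suc n. t < X k \<omega>)}
          = c / real (Suc n) * survival t ^ Suc n" (is "prob ?A = _")
    and nonrecord_step: "prob {\<omega> \<in> space M. nonrecords (\<lambda>k. X k \<omega>) n = j \<and>
            \<not> closer_than_all_previous (\<lambda>k. X k \<omega>) n \<and> (\<forall>k<Suc n. t < X k \<omega>)}
          = real n * c / real (Suc n) * survival t ^ Suc n" (is "prob ?B = _")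
proof -
  have [measurable]: "(\<lambda>p. nonrecords (fst p) n) \<in>
      measurable (PiM {..<n} (\<lambda>_. borel) \<Otimes>\<^sub>M borel) (count_space UNIV)"
    by (rule measurable_nonrecords) simp
  have meas: "Measurable.pred (PiM {..<n} (\<lambda>_. borel) \<Otimes>\<^sub>M (borel :: real measure))
      (\<lambda>p. \<forall>k\<in>{..<n}. f p < fst p k)"
    if [measurable]: "f \<in> borel_measurable (PiM {..<n} (\<lambda>_. borel) \<Otimes>\<^sub>M borel)" for f :: "_ \<Rightarrow> real"
    by (intro pred_intros_finite borel_measurable_less) auto
  have "prob {\<omega> \<in> space M. nonrecords (\<lambda>k. X k \<omega>) n = j \<and> (\<forall>k\<in>{..<n}. X n \<omega> < X k \<omega>) \<and> t < X n \<omega>}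
      = (\<integral>s. prob {\<omega> \<in> space M. nonrecords (\<lambda>k. X k \<omega>) n = j \<and> (\<forall>k\<in>{..<n}. s < X k \<omega>) \<and> t < s} \<partial>law)"
  proof (rule prob_prefix_pair[where R = "\<lambda>x s. nonrecords x n = j \<and> (\<forall>k\<in>{..<n}. s < x k) \<and> t < s"])
    show "Measurable.pred (PiM {..<n} (\<lambda>_. borel) \<Otimes>\<^sub>M borel)
        (\<lambda>(x, s). nonrecords x n = j \<and> (\<forall>k\<in>{..<n}. s < x k) \<and> t < s)"
      using meas[of snd] by (simp add: case_prod_beta')
    show "(nonrecords x n = j \<and> (\<forall>k\<in>{..<n}. s < x k) \<and> t < s) =
          (nonrecords y n = j \<and> (\<forall>k\<in>{..<n}. s < y k) \<and> t < s)" if "\<And>k. k < n \<Longrightarrow> x k = y k" for x y s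
      using nonrecords_cong[of n x y] that by auto
  qed
  also have "\<dots> = (\<integral>s. c * (indicator {t<..} s * survival s ^ n) \<partial>law)"
    using IH by (intro Bochner_Integration.integral_cong) (auto simp: indicator_def Ball_def)
  also have "\<dots> = c / real (Suc n) * survival t ^ Suc n"
    by (simp add: law.survival_power_integral[OF cont] del: of_nat_Suc)
  \<comment> \<open>At a record, \<open>t < X n\<close> and \<open>X n < X k\<close> already bound
    all earlier throws by \<open>t\<close>.\<close>
  also have "{\<omega> \<in> space M. nonrecords (\<lambda>k. X k \<omega>) n = j \<and> (\<forall>k\<in>{..<n}. X n \<omega> < X k \<omega>) \<and> t < X n \<omega>} = ?A"
    by (auto simp: closer_than_all_previous_def less_Suc_eq intro: less_trans)
  finally show A: "prob ?A = c / real (Suc n) * survival t ^ Suc n" .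

  \<comment> \<open>Without the record condition the earlier throws and throw \<open>n\<close>
    separate; the non-record case then follows by subtraction.\<close>
  have "prob {\<omega> \<in> space M. nonrecords (\<lambda>k. X k \<omega>) n = j \<and> (\<forall>k\<in>{..<n}. t < X k \<omega>) \<and> t < X n \<omega>}
      = (\<integral>s. prob {\<omega> \<in> space M. nonrecords (\<lambda>k. X k \<omega>) n = j \<and> (\<forall>k\<in>{..<n}. t < X k \<omega>) \<and> t < s} \<partial>law)"
  proof (rule prob_prefix_pair[where R = "\<lambda>x s. nonrecords x n = j \<and> (\<forall>k\<in>{..<n}. t < x k) \<and> t < s"])
    show "Measurable.pred (PiM {..<n} (\<lambda>_. borel) \<Otimes>\<^sub>M borel)
        (\<lambda>(x, s). nonrecords x n = j \<and> (\<forall>k\<in>{..<n}. t < x k) \<and> t < s)"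
      using meas[of "\<lambda>_. t"] by (simp add: case_prod_beta')
    show "(nonrecords x n = j \<and> (\<forall>k\<in>{..<n}. t < x k) \<and> t < s) =
          (nonrecords y n = j \<and> (\<forall>k\<in>{..<n}. t < y k) \<and> t < s)" if "\<And>k. k < n \<Longrightarrow> x k = y k" for x y s
      using nonrecords_cong[of n x y] that by auto
  qed
  also have "\<dots> = (\<integral>s. (c * survival t ^ n) * (indicator {t<..} s * survival s ^ 0) \<partial>law)"
    using IH[of t] by (intro Bochner_Integration.integral_cong) (auto simp: indicator_def Ball_def)
  also have "\<dots> = c * survival t ^ Suc n"
    using law.survival_power_integral[OF cont, of t 0] by simp
  also have "{\<omega> \<in> space M. nonrecords (\<lambda>k. X k \<omega>) n = j \<and> (\<forall>k\<in>{..<n}. t < X k \<omega>) \<and> t < X n \<omega>} = ?A \<union> ?B"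
    by (auto simp: less_Suc_eq)
  finally have "prob (?A \<union> ?B) = c * survival t ^ Suc n" .
  moreover have "prob (?A \<union> ?B) = prob ?A + prob ?B"
    by (rule finite_measure_Union) (auto, measurable)
  ultimately have "prob ?B = c * survival t ^ Suc n - c / real (Suc n) * survival t ^ Suc n"
    using A by simp
  also have "\<dots> = real n * c / real (Suc n) * survival t ^ Suc n"
    by (simp add: field_simps)
  finally show "prob ?B = real n * c / real (Suc n) * survival t ^ Suc n" .
qed

text \<open>The product form expresses that the count is independent of the event that all throws
  exceed \<open>t\<close>. The bound varies in the induction because the record step needs it at the
  value of the new throw.\<close>

lemma prob_nonrecords_above:
  "prob {\<omega> \<in> space M. nonrecords (\<lambda>k. X k \<omega>) n = j \<and> (\<forall>k<n. t < X k \<omega>)}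
     = fps_nth (nonrecord_gf n) j * survival t ^ n"
proof (induction n arbitrary: j t)
  case 0
  show ?case by (cases j) (auto simp: prob_space)
next
  case (Suc n)
  let ?rec = "\<lambda>j. {\<omega> \<in> space M. nonrecords (\<lambda>k. X k \<omega>) n = j \<and>
            closer_than_all_previous (\<lambda>k. X k \<omega>) n \<and> (\<forall>k<Suc n. t < X k \<omega>)}"
  let ?non = "\<lambda>j. {\<omega> \<in> space M. nonrecords (\<lambda>k. X k \<omega>) n = j \<and>
            \<not> closer_than_all_previous (\<lambda>k. X k \<omega>) n \<and> (\<forall>k<Suc n. t < X k \<omega>)}"
  have gf: "fps_nth (nonrecord_gf (Suc n)) j = fps_nth (nonrecord_gf n) j / real (Suc n) +
      (case j of 0 \<Rightarrow> 0 | Suc i \<Rightarrow> real n * fps_nth (nonrecord_gf n) i / real (Suc n))"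
    by (cases j) (simp_all add: mult.assoc distrib_right add_divide_distrib del: of_nat_Suc)
  note rec = record_step[OF Suc.IH] and non = nonrecord_step[OF Suc.IH]
  show ?case
  \<comment> \<open>Count \<open>j\<close> arises from \<open>j\<close> and a record or from
    \<open>j - 1\<close> and a non-record; for \<open>j = 0\<close> only a record is
    possible.\<close>
  proof (cases j)
    case 0
    then have "{\<omega> \<in> space M. nonrecords (\<lambda>k. X k \<omega>) (Suc n) = j \<and> (\<forall>k<Suc n. t < X k \<omega>)} = ?rec j"
      by auto
    then show ?thesis unfolding gf using 0 rec by simp
  next
    case (Suc i)
    then have "{\<omega> \<in> space M. nonrecords (\<lambda>k. X k \<omega>) (Suc n) = j \<and> (\<forall>k<Suc n. t < X k \<omega>)}
        = ?rec j \<union> ?non i"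
      by auto
    moreover have "prob (?rec j \<union> ?non i) = prob (?rec j) + prob (?non i)"
      by (rule finite_measure_Union) (auto, measurable)
    ultimately show ?thesis
      unfolding gf rec non using Suc by (simp add: distrib_right)
  qed
qed

lemma prob_nonrecords_then_nonrecord:
  assumes nonneg: "\<And>k \<omega>. \<omega> \<in> space M \<Longrightarrow> 0 \<le> X k \<omega>"
  shows "prob {\<omega> \<in> space M. nonrecords (\<lambda>k. X k \<omega>) n = j \<and>
            \<not> closer_than_all_previous (\<lambda>k. X k \<omega>) n}
       = real n / real (Suc n) * fps_nth (nonrecord_gf n) j"
proof -
  \<comment> \<open>Distances are nonnegative, so the bound \<open>t = -1\<close> is vacuous.\<close>
  have lt: "-1 < X k \<omega>" if "\<omega> \<in> space M" for k \<omega>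
    using nonneg[OF that, of k] by linarith
  then have "X 0 -` {..-1} \<inter> space M = {}"
    by (auto simp: not_le[symmetric])
  then have "survival (-1) = 1"
    by (simp add: cdf_def measure_distr)
  then show ?thesis
    using nonrecord_step[OF prob_nonrecords_above, of n j "-1"] lt by (simp cong: conj_cong)
qed

text \<open>The \<open>p - 2\<close> non-records before the last throw turn into the shift
  \<open>fps_X ^ 2\<close>; at \<open>n = 0\<close> only the game with \<open>p = 1\<close> is
  over.\<close>

lemma Q_series_nth:
  assumes nonneg: "\<And>k \<omega>. \<omega> \<in> space M \<Longrightarrow> 0 \<le> X k \<omega>"
  shows "fps_nth (Q_series M X) n = (case n of 0 \<Rightarrow> fls_X | Suc m \<Rightarrow>
     fps_to_fls (fps_const (real m / real (Suc m)) * fps_X ^ 2 * nonrecord_gf m))"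
proof (cases n)
  case 0
  have "end_prob M X 0 p = (if p = 1 then 1 else 0)" if "p \<ge> 1" for p
    using that by (auto simp: end_prob_def ends_after_0_iff prob_space)
  then have "Abs_fps (\<lambda>p. if p \<ge> 1 then end_prob M X 0 p else 0) = fps_X"
    by (auto simp: fps_eq_iff)
  then show ?thesis by (simp add: Q_series_def 0)
next
  case (Suc m)
  have "end_prob M X (Suc m) p =
      (if p < 2 then 0 else real m / real (Suc m) * fps_nth (nonrecord_gf m) (p - 2))" if "p \<ge> 1" for p
    unfolding end_prob_def ends_after_Suc_iff[OF that]
    using prob_nonrecords_then_nonrecord[OF nonneg, of m "p - 2"] by (auto simp: not_less)
  then have "Abs_fps (\<lambda>p. if p \<ge> 1 then end_prob M X (Suc m) p else 0)
      = fps_const (real m / real (Suc m)) * fps_X ^ 2 * nonrecord_gf m"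
    by (auto simp: fps_eq_iff fps_X_power_mult_nth mult.assoc)
  then show ?thesis by (simp add: Q_series_def Suc)
qed

end

theorem theorem3p1:
  fixes M :: "'a measure" and X :: "nat \<Rightarrow> 'a \<Rightarrow> real"
  assumes "prob_space M"
    and "\<And>k \<omega>. \<omega> \<in> space M \<Longrightarrow> 0 \<le> X k \<omega>"
    and "prob_space.indep_vars M (\<lambda>_. borel) X UNIV"
    and "\<And>k. distr M borel (X k) = distr M borel (X 0)"
    and "continuous_on UNIV (cdf (distr M borel (X 0)))"
  shows "Q_series M X =
    var_u + var_u ^ 2 / (1 - var_u) * (1 + (var_z - 1) / one_minus_uz_powr_inv_u)"
proof -
  interpret iid_continuous M X
    using assms by (intro iid_continuous.intro iid_continuous_axioms.intro)
  show ?thesis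
    \<comment> \<open>The expansion vanishes at \<open>z^0\<close>, so the separate summand
      \<open>var_u\<close> supplies that coefficient.\<close>
    unfolding closed_form_expansion
    by (rule fps_ext) (simp add: Q_series_nth[OF assms(2)] split: nat.split)
qed

end
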